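(* Let $R$ be an associative ring with identity and $M$ a right $R$-module. The following conditions are equivalent: (1) $M$ is SSP. (2) For any direct summand $A$ of $M$ and any split monomorphism $f: A\to M$, $A+\mathrm{Im}(f)$ is a direct summand of $M$. (3) For any direct summand $A$ of $M$ and any split epimorphism $f: M\to M/A$, $A+\mathrm{Ker}(f)$ is a direct summand of $M$.
   Context: A module $M$ is SSP if the sum of any two direct summands of $M$ is a direct summand of $M$. A split monomorphism is a monomorphism whose image is a direct summand of its codomain; a split epimorphism is an epimorphism whose kernel is a direct summand of its domain. *)

theory Defs
  imports "HOL-Algebra.Module" "HOL-Algebra.AbelCoset"
begin

text \<open>
  HOL-Algebra's locale for modules assumes a commutative ring of scalars. Here R is an arbitrary
  associative ring with identity and M is a unital right R-module. The library record is reused: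
  the term \<open>r \<odot>\<^bsub>M\<^esub> x\<close> stands for the right action \<open>x \<cdot> r\<close>, so that the associativity law
  \<open>x \<cdot> (r s) = (x \<cdot> r) \<cdot> s\<close> appears with the scalars in reversed order. As for the library's
  modules, the fields \<open>mult\<close> and \<open>one\<close> of the module record are irrelevant.
\<close>

locale right_module = R?: ring R + M?: abelian_group M
  for R :: "('r, 's) ring_scheme" (structure) and M :: "('r, 'm, 't) module_scheme" (structure) +
  assumes smult_closed [simp, intro]:
      "\<lbrakk>r \<in> carrier R; x \<in> carrier M\<rbrakk> \<Longrightarrow> r \<odot>\<^bsub>M\<^esub> x \<in> carrier M"
    and smult_l_distr:
      "\<lbrakk>r \<in> carrier R; s \<in> carrier R; x \<in> carrier M\<rbrakk>
        \<Longrightarrow> (r \<oplus>\<^bsub>R\<^esub> s) \<odot>\<^bsub>M\<^esub> x = r \<odot>\<^bsub>M\<^esub> x \<oplus>\<^bsub>M\<^esub> s \<odot>\<^bsub>M\<^esub> x"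
    and smult_r_distr:
      "\<lbrakk>r \<in> carrier R; x \<in> carrier M; y \<in> carrier M\<rbrakk>
        \<Longrightarrow> r \<odot>\<^bsub>M\<^esub> (x \<oplus>\<^bsub>M\<^esub> y) = r \<odot>\<^bsub>M\<^esub> x \<oplus>\<^bsub>M\<^esub> r \<odot>\<^bsub>M\<^esub> y"
    and smult_assoc_right:
      "\<lbrakk>r \<in> carrier R; s \<in> carrier R; x \<in> carrier M\<rbrakk>
        \<Longrightarrow> (r \<otimes>\<^bsub>R\<^esub> s) \<odot>\<^bsub>M\<^esub> x = s \<odot>\<^bsub>M\<^esub> (r \<odot>\<^bsub>M\<^esub> x)"
    and smult_one [simp]:
      "x \<in> carrier M \<Longrightarrow> \<one>\<^bsub>R\<^esub> \<odot>\<^bsub>M\<^esub> x = x"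

definition module_homs ::
    "('r, 's) ring_scheme \<Rightarrow> ('r, 'm, 't) module_scheme \<Rightarrow> ('r, 'n, 'u) module_scheme \<Rightarrow> ('m \<Rightarrow> 'n) set"
  where "module_homs R M N =
    {f \<in> carrier M \<rightarrow> carrier N.
      (\<forall>x\<in>carrier M. \<forall>y\<in>carrier M. f (x \<oplus>\<^bsub>M\<^esub> y) = f x \<oplus>\<^bsub>N\<^esub> f y) \<and>
      (\<forall>r\<in>carrier R. \<forall>x\<in>carrier M. f (r \<odot>\<^bsub>M\<^esub> x) = r \<odot>\<^bsub>N\<^esub> f x)}"

definition quotient_module ::
    "('r, 'm, 't) module_scheme \<Rightarrow> 'm set \<Rightarrow> ('r, 'm set) module"
  where "quotient_module M A =
    \<lparr>carrier = a_rcosets\<^bsub>M\<^esub> A, mult = undefined, one = undefined,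
     zero = A, add = set_add M,
     smult = (\<lambda>r X. \<Union>x\<in>X. A +>\<^bsub>M\<^esub> (r \<odot>\<^bsub>M\<^esub> x))\<rparr>"

definition direct_summand ::
    "('r, 's) ring_scheme \<Rightarrow> ('r, 'm, 't) module_scheme \<Rightarrow> 'm set \<Rightarrow> bool"
  where "direct_summand R M A \<longleftrightarrow>
    submodule A R M \<and>
    (\<exists>B. submodule B R M \<and> A <+>\<^bsub>M\<^esub> B = carrier M \<and> A \<inter> B = {\<zero>\<^bsub>M\<^esub>})"

definition ssp :: "('r, 's) ring_scheme \<Rightarrow> ('r, 'm, 't) module_scheme \<Rightarrow> bool"
  where "ssp R M \<longleftrightarrow>
    (\<forall>A B. direct_summand R M A \<and> direct_summand R M B \<longrightarrow> direct_summand R M (A <+>\<^bsub>M\<^esub> B))"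

definition split_mono ::
    "('r, 's) ring_scheme \<Rightarrow> ('r, 'm, 't) module_scheme \<Rightarrow> ('r, 'n, 'u) module_scheme \<Rightarrow> ('m \<Rightarrow> 'n) \<Rightarrow> bool"
  where "split_mono R M N f \<longleftrightarrow>
    f \<in> module_homs R M N \<and> inj_on f (carrier M) \<and> direct_summand R N (f ` carrier M)"

definition split_epi ::
    "('r, 's) ring_scheme \<Rightarrow> ('r, 'm, 't) module_scheme \<Rightarrow> ('r, 'n, 'u) module_scheme \<Rightarrow> ('m \<Rightarrow> 'n) \<Rightarrow> bool"
  where "split_epi R M N f \<longleftrightarrow>
    f \<in> module_homs R M N \<and> f ` carrier M = carrier N \<and> direct_summand R M (a_kernel M N f)"

text \<open>Submodules and quotients of right modules are right modules.\<close>

context right_module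
begin

lemma submodule_is_right_module:
  assumes "submodule A R M"
  shows "right_module R (M\<lparr>carrier := A\<rparr>)"
proof -
  interpret A: submodule A R M by fact
  have sub: "A \<subseteq> carrier M" using A.subset by simp
  have "abelian_monoid (M\<lparr>carrier := A\<rparr>)"
    using comm_monoid.submonoid_is_comm_monoid[OF M.a_comm_monoid A.subgroup_is_submonoid]
    by (simp add: abelian_monoid_def)
  moreover from this have "abelian_group_axioms (M\<lparr>carrier := A\<rparr>)"
    using A.subgroup_is_group[OF M.a_group]
    by (simp add: abelian_group_axioms_def comm_group_def abelian_monoid_def)
  ultimately have "abelian_group (M\<lparr>carrier := A\<rparr>)"
    by (rule abelian_group.intro)
  then show ?thesis
    by (intro right_module.intro right_module_axioms.intro R.ring_axioms)
       (use sub in \<open>auto simp: smult_l_distr smult_r_distr smult_assoc_right subset_iff\<close>)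
qed

lemma quotient_smult:
  assumes "submodule A R M" "r \<in> carrier R" "x \<in> carrier M"
  shows "r \<odot>\<^bsub>quotient_module M A\<^esub> (A +>\<^bsub>M\<^esub> x) = A +>\<^bsub>M\<^esub> (r \<odot>\<^bsub>M\<^esub> x)"
proof -
  interpret A: submodule A R M by fact
  have sub: "A \<subseteq> carrier M" using A.subset by simp
  interpret AA: abelian_subgroup A M
    by (intro abelian_subgroupI3 additive_subgroup.intro A.subgroup_axioms M.abelian_group_axioms)
  have "A +>\<^bsub>M\<^esub> (r \<odot>\<^bsub>M\<^esub> y) = A +>\<^bsub>M\<^esub> (r \<odot>\<^bsub>M\<^esub> x)" if y: "y \<in> A +>\<^bsub>M\<^esub> x" for y
  proof -
    obtain a where a: "a \<in> A" "y = a \<oplus>\<^bsub>M\<^esub> x"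
      using y by (auto simp: a_r_coset_def')
    have "r \<odot>\<^bsub>M\<^esub> y = (r \<odot>\<^bsub>M\<^esub> a) \<oplus>\<^bsub>M\<^esub> (r \<odot>\<^bsub>M\<^esub> x)"
      using a assms sub by (auto simp: smult_r_distr)
    then have "r \<odot>\<^bsub>M\<^esub> y \<in> A +>\<^bsub>M\<^esub> (r \<odot>\<^bsub>M\<^esub> x)"
      using a assms by (auto simp: a_r_coset_def')
    then show ?thesis
      using AA.a_repr_independence' assms by auto
  qed
  moreover have "x \<in> A +>\<^bsub>M\<^esub> x"
    using AA.a_rcos_self assms by auto
  ultimately show ?thesis
    unfolding quotient_module_def module.simps by blast
qed

lemma quotient_is_right_module:
  assumes "submodule A R M"
  shows "right_module R (quotient_module M A)"
proof -
  interpret A: submodule A R M by fact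
  interpret AA: abelian_subgroup A M
    by (intro abelian_subgroupI3 additive_subgroup.intro A.subgroup_axioms M.abelian_group_axioms)
  have ab: "abelian_group (quotient_module M A)"
  proof -
    interpret Q: comm_group "M A_Mod A"
      by (rule AA.a_factorgroup_is_comm_group)
    note Q_simps = quotient_module_def A_FactGroup_def'
    show ?thesis
    proof (rule abelian_groupI)
      show "\<exists>Y\<in>carrier (quotient_module M A). Y \<oplus>\<^bsub>quotient_module M A\<^esub> X = \<zero>\<^bsub>quotient_module M A\<^esub>"
        if "X \<in> carrier (quotient_module M A)" for X
        using that Q.l_inv_ex[of X] by (simp add: Q_simps)
    qed (use Q.m_closed Q.one_closed Q.m_assoc Q.m_comm Q.l_one in \<open>simp_all add: Q_simps\<close>)
  qed
  have car: "X \<in> carrier (quotient_module M A) \<longleftrightarrow> (\<exists>x\<in>carrier M. X = A +>\<^bsub>M\<^esub> x)" for X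
    by (auto simp: quotient_module_def A_RCOSETS_def')
  have add: "(A +>\<^bsub>M\<^esub> x) \<oplus>\<^bsub>quotient_module M A\<^esub> (A +>\<^bsub>M\<^esub> y) = A +>\<^bsub>M\<^esub> (x \<oplus>\<^bsub>M\<^esub> y)"
    if "x \<in> carrier M" "y \<in> carrier M" for x y
    using that AA.a_rcos_sum by (simp add: quotient_module_def)
  show ?thesis
    by (intro right_module.intro right_module_axioms.intro R.ring_axioms ab)
       (auto simp: car add quotient_smult[OF assms] smult_l_distr smult_r_distr smult_assoc_right)
qed

end

end

theory Submission
  imports Defs
begin

text \<open>
  Let \<open>A\<close> and \<open>B\<close> be summands with projections \<open>\<alpha>\<close> and \<open>\<beta>\<close>, and let \<open>B'\<close> be the kernel of \<open>\<beta>\<close>. The graph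
  \<open>K\<close> of \<open>(1 - \<alpha>) \<beta> : A \<rightarrow> (1 - \<alpha>) M\<close> is a complement of \<open>(1 - \<alpha>) M\<close>, hence at the same time the
  image of a split monomorphism \<open>A \<rightarrow> M\<close> and the kernel of a split epimorphism \<open>M \<rightarrow> M/A\<close>, namely
  \<open>x \<mapsto> x - \<beta> (\<alpha> x) + A\<close>. Moreover \<open>A + K = A + \<beta> A = (A + B) \<inter> (A + B')\<close>. So (2) or (3) makes this
  intersection a summand, and as \<open>A + B\<close> and \<open>A + B'\<close> together span \<open>M\<close>, the modular law
  makes \<open>A + B\<close> a summand as well.
\<close>

context right_module
begin

section \<open>Arithmetic of the right action\<close>

lemma smult_zero_right: "r \<in> carrier R \<Longrightarrow> r \<odot>\<^bsub>M\<^esub> \<zero>\<^bsub>M\<^esub> = \<zero>\<^bsub>M\<^esub>"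
  by (metis M.add.r_cancel_one' M.l_zero M.zero_closed smult_closed smult_r_distr)

lemma smult_minus_right:
  assumes "r \<in> carrier R" "x \<in> carrier M"
  shows "r \<odot>\<^bsub>M\<^esub> (\<ominus>\<^bsub>M\<^esub> x) = \<ominus>\<^bsub>M\<^esub> (r \<odot>\<^bsub>M\<^esub> x)"
  using assms
  by (metis M.a_inv_closed M.l_neg M.minus_equality smult_closed smult_r_distr smult_zero_right)

lemma diff_add_cancel:
  "x \<in> carrier M \<Longrightarrow> y \<in> carrier M \<Longrightarrow> y \<oplus>\<^bsub>M\<^esub> (x \<ominus>\<^bsub>M\<^esub> y) = x"
  by (simp add: M.minus_eq M.a_comm[of x] M.r_neg2)

lemma add_diff_cancel:
  "x \<in> carrier M \<Longrightarrow> y \<in> carrier M \<Longrightarrow> (x \<oplus>\<^bsub>M\<^esub> y) \<ominus>\<^bsub>M\<^esub> x = y"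
  by (simp add: M.minus_eq M.a_comm[of _ "\<ominus>\<^bsub>M\<^esub> x"] M.r_neg1)

section \<open>Submodules, their intersections and sums\<close>

lemma submoduleI:
  assumes "H \<subseteq> carrier M" "\<zero>\<^bsub>M\<^esub> \<in> H"
    and "\<And>x. x \<in> H \<Longrightarrow> \<ominus>\<^bsub>M\<^esub> x \<in> H"
    and "\<And>x y. x \<in> H \<Longrightarrow> y \<in> H \<Longrightarrow> x \<oplus>\<^bsub>M\<^esub> y \<in> H"
    and "\<And>r x. r \<in> carrier R \<Longrightarrow> x \<in> H \<Longrightarrow> r \<odot>\<^bsub>M\<^esub> x \<in> H"
  shows "submodule H R M"
  using assms
  by (intro submodule.intro subgroup.intro submodule_axioms.intro) (auto simp: a_inv_def)

lemma submoduleD: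
  assumes "submodule H R M"
  shows "H \<subseteq> carrier M" "\<zero>\<^bsub>M\<^esub> \<in> H"
    and "\<And>x. x \<in> H \<Longrightarrow> x \<in> carrier M"
    and "\<And>x. x \<in> H \<Longrightarrow> \<ominus>\<^bsub>M\<^esub> x \<in> H"
    and "\<And>x y. x \<in> H \<Longrightarrow> y \<in> H \<Longrightarrow> x \<oplus>\<^bsub>M\<^esub> y \<in> H"
    and "\<And>x y. x \<in> H \<Longrightarrow> y \<in> H \<Longrightarrow> x \<ominus>\<^bsub>M\<^esub> y \<in> H"
    and "\<And>r x. r \<in> carrier R \<Longrightarrow> x \<in> H \<Longrightarrow> r \<odot>\<^bsub>M\<^esub> x \<in> H"
proof -
  interpret H: submodule H R M by fact
  show sub: "H \<subseteq> carrier M" using H.subset by simp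
  then show "x \<in> H \<Longrightarrow> x \<in> carrier M" for x by auto
  show "\<zero>\<^bsub>M\<^esub> \<in> H" using H.one_closed by simp
  show inv: "x \<in> H \<Longrightarrow> \<ominus>\<^bsub>M\<^esub> x \<in> H" for x using H.m_inv_closed by (simp add: a_inv_def)
  show add: "x \<in> H \<Longrightarrow> y \<in> H \<Longrightarrow> x \<oplus>\<^bsub>M\<^esub> y \<in> H" for x y using H.m_closed by simp
  show "x \<in> H \<Longrightarrow> y \<in> H \<Longrightarrow> x \<ominus>\<^bsub>M\<^esub> y \<in> H" for x y
    using inv add by (simp add: a_minus_def)
  show "\<And>r x. r \<in> carrier R \<Longrightarrow> x \<in> H \<Longrightarrow> r \<odot>\<^bsub>M\<^esub> x \<in> H" by simp
qed

lemma submodule_inter: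
  assumes "submodule A R M" "submodule B R M"
  shows "submodule (A \<inter> B) R M"
  using submoduleD[OF assms(1)] submoduleD[OF assms(2)] by (intro submoduleI) auto

lemma mem_set_add: "x \<in> A <+>\<^bsub>M\<^esub> B \<longleftrightarrow> (\<exists>a\<in>A. \<exists>b\<in>B. x = a \<oplus>\<^bsub>M\<^esub> b)"
  by (auto simp: set_add_def')

lemma submodule_set_add:
  assumes "submodule A R M" "submodule B R M"
  shows "submodule (A <+>\<^bsub>M\<^esub> B) R M"
proof -
  note A = submoduleD[OF assms(1)] and B = submoduleD[OF assms(2)]
  show ?thesis
  proof (rule submoduleI)
    show "\<zero>\<^bsub>M\<^esub> \<in> A <+>\<^bsub>M\<^esub> B" using A(2) B(2) by (force simp: mem_set_add)
    show "\<ominus>\<^bsub>M\<^esub> x \<in> A <+>\<^bsub>M\<^esub> B" if x: "x \<in> A <+>\<^bsub>M\<^esub> B" for x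
    proof -
      obtain a b where *: "a \<in> A" "b \<in> B" "x = a \<oplus>\<^bsub>M\<^esub> b"
        using x unfolding mem_set_add by blast
      then have "\<ominus>\<^bsub>M\<^esub> x = \<ominus>\<^bsub>M\<^esub> a \<oplus>\<^bsub>M\<^esub> \<ominus>\<^bsub>M\<^esub> b"
        using A(3) B(3) by (simp add: M.minus_add)
      then show ?thesis using * A(4) B(4) unfolding mem_set_add by blast
    qed
    show "x \<oplus>\<^bsub>M\<^esub> y \<in> A <+>\<^bsub>M\<^esub> B" if xy: "x \<in> A <+>\<^bsub>M\<^esub> B" "y \<in> A <+>\<^bsub>M\<^esub> B" for x y
    proof -
      obtain a b a' b' where *: "a \<in> A" "b \<in> B" "x = a \<oplus>\<^bsub>M\<^esub> b" "a' \<in> A" "b' \<in> B" "y = a' \<oplus>\<^bsub>M\<^esub> b'"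
        using xy unfolding mem_set_add by blast
      then have "x \<oplus>\<^bsub>M\<^esub> y = (a \<oplus>\<^bsub>M\<^esub> a') \<oplus>\<^bsub>M\<^esub> (b \<oplus>\<^bsub>M\<^esub> b')"
        using A(3) B(3) by (simp add: M.a_ac)
      then show ?thesis using * A(5) B(5) unfolding mem_set_add by blast
    qed
    show "r \<odot>\<^bsub>M\<^esub> x \<in> A <+>\<^bsub>M\<^esub> B" if r: "r \<in> carrier R" and x: "x \<in> A <+>\<^bsub>M\<^esub> B" for r x
    proof -
      obtain a b where *: "a \<in> A" "b \<in> B" "x = a \<oplus>\<^bsub>M\<^esub> b"
        using x unfolding mem_set_add by blast
      then have "r \<odot>\<^bsub>M\<^esub> x = r \<odot>\<^bsub>M\<^esub> a \<oplus>\<^bsub>M\<^esub> r \<odot>\<^bsub>M\<^esub> b"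
        using r A(3) B(3) by (simp add: smult_r_distr)
      then show ?thesis using r * A(7) B(7) unfolding mem_set_add by blast
    qed
  qed (use A(3) B(3) in \<open>auto simp: mem_set_add\<close>)
qed

text \<open>If \<open>E\<close> is a complement of \<open>X \<inter> Y\<close>, then
  \<open>Y \<inter> E\<close> is a complement of \<open>X\<close>. By the modular law
  \<open>Y\<close> is the sum of \<open>X \<inter> Y\<close> and \<open>Y \<inter> E\<close>, so
  adding \<open>X\<close> gives \<open>X + Y\<close>, which is everything; the intersection is
  trivial by the choice of \<open>E\<close>.\<close>

lemma direct_summand_if_inter:
  assumes X: "submodule X R M" and Y: "submodule Y R M"
    and XY: "X <+>\<^bsub>M\<^esub> Y = carrier M" and "direct_summand R M (X \<inter> Y)"
  shows "direct_summand R M X"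
proof -
  obtain E where E: "submodule E R M" and sum: "(X \<inter> Y) <+>\<^bsub>M\<^esub> E = carrier M"
    and int: "X \<inter> Y \<inter> E = {\<zero>\<^bsub>M\<^esub>}"
    using assms(4) unfolding direct_summand_def by blast
  note X' = submoduleD[OF X] and Y' = submoduleD[OF Y] and E' = submoduleD[OF E]
  have YE: "submodule (Y \<inter> E) R M" by (rule submodule_inter[OF Y E])
  have "m \<in> X <+>\<^bsub>M\<^esub> (Y \<inter> E)" if m: "m \<in> carrier M" for m
  proof -
    obtain x y where xy: "x \<in> X" "y \<in> Y" "m = x \<oplus>\<^bsub>M\<^esub> y"
      using m XY unfolding mem_set_add[symmetric] by (metis mem_set_add)
    obtain c e where ce: "c \<in> X" "c \<in> Y" "e \<in> E" "y = c \<oplus>\<^bsub>M\<^esub> e"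
      using xy(2) Y'(3) sum by (metis Int_iff mem_set_add)
    \<comment> \<open>The part \<open>e\<close> of \<open>y\<close> stays in \<open>Y\<close>
      because both \<open>y\<close> and \<open>c\<close> lie there, while \<open>c\<close> also lies
      in \<open>X\<close> and is absorbed by the \<open>X\<close>-part of \<open>m\<close>.\<close>
    have "e = y \<ominus>\<^bsub>M\<^esub> c"
      using ce Y'(3) E'(3) add_diff_cancel by simp
    then have "e \<in> Y \<inter> E" using Y'(6)[OF xy(2) ce(2)] ce(3) by simp
    moreover have "m = (x \<oplus>\<^bsub>M\<^esub> c) \<oplus>\<^bsub>M\<^esub> e"
      using xy ce X'(3) E'(3) by (simp add: M.a_assoc)
    ultimately show ?thesis using X'(5) xy ce unfolding mem_set_add by blast
  qed
  then have "X <+>\<^bsub>M\<^esub> (Y \<inter> E) = carrier M"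
    using submoduleD(1)[OF submodule_set_add[OF X YE]] by auto
  then show ?thesis
    unfolding direct_summand_def using X YE int by (auto simp: Int_assoc)
qed

section \<open>Endomorphisms of the module\<close>

lemma endoD:
  assumes "f \<in> module_homs R M M"
  shows "\<And>x. x \<in> carrier M \<Longrightarrow> f x \<in> carrier M"
    and "\<And>x y. x \<in> carrier M \<Longrightarrow> y \<in> carrier M \<Longrightarrow> f (x \<oplus>\<^bsub>M\<^esub> y) = f x \<oplus>\<^bsub>M\<^esub> f y"
    and "\<And>r x. r \<in> carrier R \<Longrightarrow> x \<in> carrier M \<Longrightarrow> f (r \<odot>\<^bsub>M\<^esub> x) = r \<odot>\<^bsub>M\<^esub> f x"
    and "f \<zero>\<^bsub>M\<^esub> = \<zero>\<^bsub>M\<^esub>"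
    and "\<And>x. x \<in> carrier M \<Longrightarrow> f (\<ominus>\<^bsub>M\<^esub> x) = \<ominus>\<^bsub>M\<^esub> f x"
    and "\<And>x y. x \<in> carrier M \<Longrightarrow> y \<in> carrier M \<Longrightarrow> f (x \<ominus>\<^bsub>M\<^esub> y) = f x \<ominus>\<^bsub>M\<^esub> f y"
proof -
  show cl: "x \<in> carrier M \<Longrightarrow> f x \<in> carrier M" for x
    using assms unfolding module_homs_def by blast
  show add: "x \<in> carrier M \<Longrightarrow> y \<in> carrier M \<Longrightarrow> f (x \<oplus>\<^bsub>M\<^esub> y) = f x \<oplus>\<^bsub>M\<^esub> f y" for x y
    using assms unfolding module_homs_def by blast
  show "r \<in> carrier R \<Longrightarrow> x \<in> carrier M \<Longrightarrow> f (r \<odot>\<^bsub>M\<^esub> x) = r \<odot>\<^bsub>M\<^esub> f x" for r x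
    using assms unfolding module_homs_def by blast
  show zero: "f \<zero>\<^bsub>M\<^esub> = \<zero>\<^bsub>M\<^esub>"
    by (metis M.add.r_cancel_one' M.l_zero M.zero_closed add cl)
  show minus: "x \<in> carrier M \<Longrightarrow> f (\<ominus>\<^bsub>M\<^esub> x) = \<ominus>\<^bsub>M\<^esub> f x" for x
    by (metis M.a_inv_closed M.l_neg M.minus_equality add cl zero)
  show "x \<in> carrier M \<Longrightarrow> y \<in> carrier M \<Longrightarrow> f (x \<ominus>\<^bsub>M\<^esub> y) = f x \<ominus>\<^bsub>M\<^esub> f y" for x y
    by (simp add: a_minus_def add minus)
qed

lemma endo_ident: "(\<lambda>x. x) \<in> module_homs R M M"
  by (simp add: module_homs_def)

lemma endo_compose:
  assumes "f \<in> module_homs R M M" "g \<in> module_homs R M M"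
  shows "(\<lambda>x. f (g x)) \<in> module_homs R M M"
  using endoD[OF assms(1)] endoD[OF assms(2)] by (simp add: module_homs_def)

lemma endo_add:
  assumes "f \<in> module_homs R M M" "g \<in> module_homs R M M"
  shows "(\<lambda>x. f x \<oplus>\<^bsub>M\<^esub> g x) \<in> module_homs R M M"
  using endoD(1-3)[OF assms(1)] endoD(1-3)[OF assms(2)]
  by (simp add: module_homs_def M.a_ac smult_r_distr)

lemma endo_diff:
  assumes "f \<in> module_homs R M M" "g \<in> module_homs R M M"
  shows "(\<lambda>x. f x \<ominus>\<^bsub>M\<^esub> g x) \<in> module_homs R M M"
proof -
  have "(\<lambda>x. \<ominus>\<^bsub>M\<^esub> g x) \<in> module_homs R M M"
    using endoD(1-3)[OF assms(2)]
    by (simp add: module_homs_def M.minus_add smult_minus_right)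
  from endo_add[OF assms(1) this] show ?thesis by (simp add: a_minus_def)
qed

lemma endo_image_submodule:
  assumes f: "f \<in> module_homs R M M"
  shows "submodule (f ` carrier M) R M"
proof (rule submoduleI)
  note f' = endoD[OF f]
  show "f ` carrier M \<subseteq> carrier M" using f'(1) by auto
  show "\<zero>\<^bsub>M\<^esub> \<in> f ` carrier M" using f'(4) by (metis M.zero_closed imageI)
qed (auto simp: endoD(2,3,5)[OF f, symmetric])

lemma endo_kernel_submodule:
  assumes f: "f \<in> module_homs R M M"
  shows "submodule {x \<in> carrier M. f x = \<zero>\<^bsub>M\<^esub>} R M"
  by (rule submoduleI) (auto simp: endoD[OF f] smult_zero_right)

section \<open>Idempotent endomorphisms and direct sum decompositions\<close>

text \<open>The kernel is a complement of the image: \<open>x\<close> is \<open>p x\<close> plus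
  \<open>x \<ominus> p x\<close>, and \<open>p\<close> kills the second term. An element of the
  image is fixed by \<open>p\<close>, so it vanishes if it is also in the kernel.\<close>

lemma idempotent_image_direct_summand:
  assumes p: "p \<in> module_homs R M M" and idem: "\<And>x. x \<in> carrier M \<Longrightarrow> p (p x) = p x"
  shows "direct_summand R M (p ` carrier M)"
proof -
  note p' = endoD[OF p]
  let ?K = "{x \<in> carrier M. p x = \<zero>\<^bsub>M\<^esub>}"
  have "x \<in> p ` carrier M <+>\<^bsub>M\<^esub> ?K" if x: "x \<in> carrier M" for x
  proof -
    have "x = p x \<oplus>\<^bsub>M\<^esub> (x \<ominus>\<^bsub>M\<^esub> p x)" using x p'(1) diff_add_cancel by simp
    moreover have "p (x \<ominus>\<^bsub>M\<^esub> p x) = \<zero>\<^bsub>M\<^esub>"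
      using x p'(1) idem by (simp add: p'(6)) (simp add: a_minus_def M.r_neg)
    ultimately show ?thesis using x p'(1) unfolding mem_set_add by blast
  qed
  moreover have "p ` carrier M <+>\<^bsub>M\<^esub> ?K \<subseteq> carrier M"
    using p'(1) by (auto simp: mem_set_add)
  moreover have "p ` carrier M \<inter> ?K = {\<zero>\<^bsub>M\<^esub>}"
    using idem p'(4) by (force simp: image_iff)
  ultimately show ?thesis
    unfolding direct_summand_def
    using endo_image_submodule[OF p] endo_kernel_submodule[OF p] by blast
qed

text \<open>The \<open>A\<close>-component of an element is unique because \<open>A\<close> and
  \<open>B\<close> meet only in zero, and uniqueness makes a pointwise choice of components linear.
  The last clause records that the projection is along \<open>B\<close>.\<close>

lemma direct_sum_projection:
  assumes A: "submodule A R M" and B: "submodule B R M"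
    and sum: "A <+>\<^bsub>M\<^esub> B = carrier M" and int: "A \<inter> B = {\<zero>\<^bsub>M\<^esub>}"
  obtains p where "p \<in> module_homs R M M" "\<And>x. x \<in> carrier M \<Longrightarrow> p x \<in> A"
    "\<And>x. x \<in> A \<Longrightarrow> p x = x" "\<And>x. x \<in> carrier M \<Longrightarrow> x \<ominus>\<^bsub>M\<^esub> p x \<in> B"
proof -
  note A' = submoduleD[OF A] and B' = submoduleD[OF B]
  define p where "p x = (SOME a. a \<in> A \<and> x \<ominus>\<^bsub>M\<^esub> a \<in> B)" for x
  have p: "p x \<in> A" "x \<ominus>\<^bsub>M\<^esub> p x \<in> B" if x: "x \<in> carrier M" for x
  proof -
    obtain a b where ab: "a \<in> A" "b \<in> B" "x = a \<oplus>\<^bsub>M\<^esub> b"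
      using x sum by (metis mem_set_add)
    then have "x \<ominus>\<^bsub>M\<^esub> a = b"
      using A'(3) B'(3) add_diff_cancel by simp
    then have "\<exists>a. a \<in> A \<and> x \<ominus>\<^bsub>M\<^esub> a \<in> B" using ab by auto
    then show "p x \<in> A" "x \<ominus>\<^bsub>M\<^esub> p x \<in> B"
      unfolding p_def by (metis (mono_tags, lifting) someI_ex)+
  qed
  have unique: "p x = a" if x: "x \<in> carrier M" and a: "a \<in> A" "x \<ominus>\<^bsub>M\<^esub> a \<in> B" for x a
  proof -
    have c: "x \<in> carrier M" "a \<in> carrier M" "p x \<in> carrier M" using x a(1) p A'(3) by auto
    \<comment> \<open>The difference of two candidates lies in \<open>A\<close> since both do, and
      in \<open>B\<close> since it is also the difference of their two remainders. Hence it is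
      zero.\<close>
    have "(x \<ominus>\<^bsub>M\<^esub> a) \<ominus>\<^bsub>M\<^esub> (x \<ominus>\<^bsub>M\<^esub> p x) = p x \<ominus>\<^bsub>M\<^esub> a"
    proof -
      have "x \<ominus>\<^bsub>M\<^esub> a = (x \<ominus>\<^bsub>M\<^esub> p x) \<oplus>\<^bsub>M\<^esub> (p x \<ominus>\<^bsub>M\<^esub> a)"
        using c by (simp add: a_minus_def M.a_assoc M.r_neg1)
      then show ?thesis using c by (simp add: add_diff_cancel)
    qed
    then have "p x \<ominus>\<^bsub>M\<^esub> a \<in> A \<inter> B" using p[OF x] a A'(6) B'(6) by (metis IntI)
    then show ?thesis using int c diff_add_cancel[of "p x" a] by simp
  qed
  have "p \<in> module_homs R M M"
    unfolding module_homs_def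
  proof (intro CollectI conjI ballI)
    show "p \<in> carrier M \<rightarrow> carrier M" using p(1) A'(3) by auto
    show "p (x \<oplus>\<^bsub>M\<^esub> y) = p x \<oplus>\<^bsub>M\<^esub> p y" if "x \<in> carrier M" "y \<in> carrier M" for x y
    \<comment> \<open>Componentwise sums are again an admissible decomposition, so uniqueness
      identifies them with the chosen one; the same argument serves for scalars below.\<close>
    proof (rule unique)
      have "(x \<oplus>\<^bsub>M\<^esub> y) \<ominus>\<^bsub>M\<^esub> (p x \<oplus>\<^bsub>M\<^esub> p y) = (x \<ominus>\<^bsub>M\<^esub> p x) \<oplus>\<^bsub>M\<^esub> (y \<ominus>\<^bsub>M\<^esub> p y)"
        using that p(1) A'(3) by (simp add: a_minus_def M.minus_add M.a_ac)
      then show "(x \<oplus>\<^bsub>M\<^esub> y) \<ominus>\<^bsub>M\<^esub> (p x \<oplus>\<^bsub>M\<^esub> p y) \<in> B" using that p B'(5) by simp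
    qed (use that p A'(5) in auto)
    show "p (r \<odot>\<^bsub>M\<^esub> x) = r \<odot>\<^bsub>M\<^esub> p x" if "r \<in> carrier R" "x \<in> carrier M" for r x
    proof (rule unique)
      have "r \<odot>\<^bsub>M\<^esub> x \<ominus>\<^bsub>M\<^esub> r \<odot>\<^bsub>M\<^esub> p x = r \<odot>\<^bsub>M\<^esub> (x \<ominus>\<^bsub>M\<^esub> p x)"
        using that p(1) A'(3) by (simp add: a_minus_def smult_r_distr smult_minus_right)
      then show "r \<odot>\<^bsub>M\<^esub> x \<ominus>\<^bsub>M\<^esub> r \<odot>\<^bsub>M\<^esub> p x \<in> B" using that p B'(7) by simp
    qed (use that p A'(7) in auto)
  qed
  moreover have "p x = x" if "x \<in> A" for x
    using that A'(3) B'(2) by (intro unique) (auto simp: a_minus_def M.r_neg)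
  ultimately show thesis using p that by blast
qed

section \<open>The graph attached to two direct summands\<close>

text \<open>The image of \<open>\<gamma>\<close> is the graph \<open>K\<close>.\<close>

lemma graph_endomorphism:
  assumes A: "direct_summand R M A" and B: "direct_summand R M B"
  obtains \<alpha> \<beta> \<gamma> where "\<alpha> \<in> module_homs R M M" "\<beta> \<in> module_homs R M M" "\<gamma> \<in> module_homs R M M"
    "\<And>x. x \<in> carrier M \<Longrightarrow> \<alpha> x \<in> A" "\<And>x. x \<in> A \<Longrightarrow> \<alpha> x = x"
    "\<And>x. x \<in> carrier M \<Longrightarrow> \<gamma> x = \<alpha> x \<oplus>\<^bsub>M\<^esub> (\<beta> (\<alpha> x) \<ominus>\<^bsub>M\<^esub> \<alpha> (\<beta> (\<alpha> x)))"
    "\<And>x. x \<in> carrier M \<Longrightarrow> \<alpha> (\<gamma> x) = \<alpha> x" "\<And>x. x \<in> carrier M \<Longrightarrow> \<gamma> (\<alpha> x) = \<gamma> x"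
    "direct_summand R M (\<gamma> ` carrier M)"
    "direct_summand R M (A <+>\<^bsub>M\<^esub> \<gamma> ` carrier M) \<Longrightarrow> direct_summand R M (A <+>\<^bsub>M\<^esub> B)"
proof -
  obtain A2 where A2: "submodule A R M" "submodule A2 R M" "A <+>\<^bsub>M\<^esub> A2 = carrier M"
      "A \<inter> A2 = {\<zero>\<^bsub>M\<^esub>}"
    using A unfolding direct_summand_def by blast
  obtain B2 where B2: "submodule B R M" "submodule B2 R M" "B <+>\<^bsub>M\<^esub> B2 = carrier M"
      "B \<inter> B2 = {\<zero>\<^bsub>M\<^esub>}"
    using B unfolding direct_summand_def by blast
  note A' = submoduleD[OF A2(1)] and B' = submoduleD[OF B2(1)] and B2' = submoduleD[OF B2(2)]
  obtain \<alpha> where \<alpha>: "\<alpha> \<in> module_homs R M M" "\<And>x. x \<in> carrier M \<Longrightarrow> \<alpha> x \<in> A"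
    "\<And>x. x \<in> A \<Longrightarrow> \<alpha> x = x" "\<And>x. x \<in> carrier M \<Longrightarrow> x \<ominus>\<^bsub>M\<^esub> \<alpha> x \<in> A2"
    using direct_sum_projection[OF A2] by blast
  obtain \<beta> where \<beta>: "\<beta> \<in> module_homs R M M" "\<And>x. x \<in> carrier M \<Longrightarrow> \<beta> x \<in> B"
    "\<And>x. x \<in> B \<Longrightarrow> \<beta> x = x" "\<And>x. x \<in> carrier M \<Longrightarrow> x \<ominus>\<^bsub>M\<^esub> \<beta> x \<in> B2"
    using direct_sum_projection[OF B2] by blast
  note \<alpha>' = endoD[OF \<alpha>(1)] and \<beta>' = endoD[OF \<beta>(1)]
  \<comment> \<open>This is \<alpha> + (1 - \<alpha>) \<beta> \<alpha>, which sends \<open>x\<close>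
    to the point of the graph above \<alpha> x.\<close>
  define \<gamma> where "\<gamma> x = \<alpha> x \<oplus>\<^bsub>M\<^esub> (\<beta> (\<alpha> x) \<ominus>\<^bsub>M\<^esub> \<alpha> (\<beta> (\<alpha> x)))" for x
  have \<gamma>: "\<gamma> \<in> module_homs R M M"
    unfolding \<gamma>_def
    by (intro endo_add endo_diff \<alpha>(1) endo_compose[OF \<beta>(1) \<alpha>(1)]
        endo_compose[OF \<alpha>(1) endo_compose[OF \<beta>(1) \<alpha>(1)]])
  have \<alpha>\<alpha>: "\<alpha> (\<alpha> x) = \<alpha> x" if "x \<in> carrier M" for x using \<alpha> that by simp
  have \<alpha>\<gamma>: "\<alpha> (\<gamma> x) = \<alpha> x" if "x \<in> carrier M" for x
    using that \<alpha>'(1) \<beta>'(1)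
    by (simp add: \<gamma>_def \<alpha>'(2,6) \<alpha>\<alpha>) (simp add: a_minus_def M.r_neg)
  have \<gamma>\<alpha>: "\<gamma> (\<alpha> x) = \<gamma> x" if "x \<in> carrier M" for x
    using that by (simp add: \<gamma>_def \<alpha>\<alpha>)
  \<comment> \<open>Idempotence follows from the two preceding identities: \<gamma> \<gamma> =
    \<gamma> \<alpha> \<gamma> = \<gamma> \<alpha> = \<gamma>.\<close>
  have \<gamma>\<gamma>: "\<gamma> (\<gamma> x) = \<gamma> x" if "x \<in> carrier M" for x
    using \<gamma>\<alpha>[OF that] \<gamma>\<alpha>[OF endoD(1)[OF \<gamma> that]] \<alpha>\<gamma>[OF that] by simp
  have summand: "direct_summand R M (\<gamma> ` carrier M)"
    by (rule idempotent_image_direct_summand[OF \<gamma> \<gamma>\<gamma>])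
  let ?X = "A <+>\<^bsub>M\<^esub> B" and ?Y = "A <+>\<^bsub>M\<^esub> B2"
  have X: "submodule ?X R M" and Y: "submodule ?Y R M"
    using A2 B2 submodule_set_add by auto
  note X' = submoduleD[OF X] and Y' = submoduleD[OF Y]
  have AX: "a \<in> ?X" and AY: "a \<in> ?Y" if "a \<in> A" for a
    using that A'(3) B'(2) B2'(2) by (force simp: mem_set_add)+
  have BX: "b \<in> ?X" if "b \<in> B" for b
    using that B'(3) A'(2) by (force simp: mem_set_add)
  have B2Y: "b \<in> ?Y" if "b \<in> B2" for b
    using that B2'(3) A'(2) by (force simp: mem_set_add)
  have XY: "?X <+>\<^bsub>M\<^esub> ?Y = carrier M"
  proof
    show "?X <+>\<^bsub>M\<^esub> ?Y \<subseteq> carrier M" using X Y submodule_set_add submoduleD(1) by blast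
    \<comment> \<open>Rewriting \<open>carrier M\<close> back into the sum of \<open>B\<close> and
      \<open>B2\<close> reduces the claim to \<open>B\<close> lying in the first summand and
      \<open>B2\<close> in the second.\<close>
    show "carrier M \<subseteq> ?X <+>\<^bsub>M\<^esub> ?Y"
      using BX B2Y unfolding B2(3)[symmetric] subset_iff mem_set_add[of _ ?X] mem_set_add[of _ B]
      by blast
  qed
  have "A <+>\<^bsub>M\<^esub> \<gamma> ` carrier M = ?X \<inter> ?Y"
  proof (intro equalityI subsetI)
    fix z assume "z \<in> A <+>\<^bsub>M\<^esub> \<gamma> ` carrier M"
    then obtain a x where z: "a \<in> A" "x \<in> carrier M" "z = a \<oplus>\<^bsub>M\<^esub> \<gamma> x"
      by (auto simp: mem_set_add)
    have in_A: "\<alpha> x \<in> A" "\<alpha> (\<beta> (\<alpha> x)) \<in> A" and in_M: "\<alpha> x \<in> carrier M"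
      using z \<alpha>(2) \<alpha>'(1) \<beta>'(1) by auto
    \<comment> \<open>Modulo \<open>A\<close>, the point \<gamma> x is \<beta> (\<alpha> x). The
      latter lies in \<open>B\<close>, and it differs from the element \<alpha> x of
      \<open>A\<close> by an element of \<open>B2\<close>, so it is in both sums.\<close>
    have "\<beta> (\<alpha> x) = \<alpha> x \<ominus>\<^bsub>M\<^esub> (\<alpha> x \<ominus>\<^bsub>M\<^esub> \<beta> (\<alpha> x))"
      using in_M \<beta>'(1) by (simp add: a_minus_def M.minus_add M.r_neg2)
    moreover have "\<dots> \<in> ?Y" by (intro Y'(6) AY in_A(1) B2Y \<beta>(4) in_M)
    ultimately have "\<beta> (\<alpha> x) \<in> ?X \<inter> ?Y" using BX \<beta>(2) in_M by auto
    then show "z \<in> ?X \<inter> ?Y"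
      unfolding z(3) \<gamma>_def
      by (intro IntI X'(5,6) Y'(5,6) AX[OF z(1)] AY[OF z(1)] AX[OF in_A(1)] AY[OF in_A(1)]
          AX[OF in_A(2)] AY[OF in_A(2)]) auto
  next
    fix z assume z: "z \<in> ?X \<inter> ?Y"
    obtain a b where ab: "a \<in> A" "b \<in> B" "z = a \<oplus>\<^bsub>M\<^esub> b"
      using z by (auto simp: mem_set_add)
    obtain c d where cd: "c \<in> A" "d \<in> B2" "z = c \<oplus>\<^bsub>M\<^esub> d"
      using z by (auto simp: mem_set_add)
    note in_M = A'(3)[OF ab(1)] B'(3)[OF ab(2)] A'(3)[OF cd(1)] B2'(3)[OF cd(2)]
    \<comment> \<open>The two decompositions of \<open>z\<close> give \<open>b = e + d\<close> with
      \<open>e\<close> in \<open>A\<close> and \<open>d\<close> in \<open>B2\<close>. Applying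
      \<beta> removes \<open>d\<close> and exhibits \<open>b\<close> as \<beta> e.\<close>
    define e where "e = c \<ominus>\<^bsub>M\<^esub> a"
    have e: "e \<in> A" "e \<in> carrier M" using ab cd A'(3,6) by (auto simp: e_def)
    have e_eq: "e \<oplus>\<^bsub>M\<^esub> d = b"
    proof -
      have "e \<oplus>\<^bsub>M\<^esub> d = \<ominus>\<^bsub>M\<^esub> a \<oplus>\<^bsub>M\<^esub> z"
        using in_M by (simp add: e_def cd(3) a_minus_def M.a_ac)
      then show ?thesis using in_M by (simp add: ab(3) M.r_neg1)
    qed
    have "\<beta> d = \<zero>\<^bsub>M\<^esub>"
    proof -
      have "d \<ominus>\<^bsub>M\<^esub> (d \<ominus>\<^bsub>M\<^esub> \<beta> d) = \<beta> d"
        using in_M \<beta>'(1) by (simp add: a_minus_def M.minus_add M.r_neg2)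
      then have "\<beta> d \<in> B \<inter> B2" using \<beta>(2,4) in_M cd(2) B2'(6) by (metis IntI)
      then show ?thesis using B2(4) by simp
    qed
    then have \<beta>e: "\<beta> e = b"
      using e_eq \<beta>(3)[OF ab(2)] \<beta>'(2)[OF e(2) in_M(4)] \<beta>'(1)[OF e(2)] by simp
    have \<gamma>e: "\<gamma> e = e \<oplus>\<^bsub>M\<^esub> (b \<ominus>\<^bsub>M\<^esub> \<alpha> b)"
      using \<alpha>(3)[OF e(1)] \<beta>e by (simp add: \<gamma>_def)
    \<comment> \<open>Since \<gamma> e is \<open>e\<close> plus \<open>b\<close> minus \<alpha> b,
      it agrees with \<open>b\<close>, and so with \<open>z\<close>, up to an element of
      \<open>A\<close>.\<close>
    have "z = (a \<ominus>\<^bsub>M\<^esub> e \<oplus>\<^bsub>M\<^esub> \<alpha> b) \<oplus>\<^bsub>M\<^esub> \<gamma> e"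
      unfolding \<gamma>e ab(3) using in_M e(2) \<alpha>'(1)
      by (simp add: a_minus_def M.a_ac M.r_neg1 M.r_neg2 M.r_neg)
    moreover have "a \<ominus>\<^bsub>M\<^esub> e \<oplus>\<^bsub>M\<^esub> \<alpha> b \<in> A"
      by (intro A'(5,6) ab(1) e(1) \<alpha>(2) in_M(2))
    ultimately show "z \<in> A <+>\<^bsub>M\<^esub> \<gamma> ` carrier M"
      using e(2) unfolding mem_set_add by blast
  qed
  then have "direct_summand R M (A <+>\<^bsub>M\<^esub> \<gamma> ` carrier M) \<Longrightarrow> direct_summand R M ?X"
    using direct_summand_if_inter[OF X Y XY] by simp
  then show thesis
    using that[OF \<alpha>(1) \<beta>(1) \<gamma> \<alpha>(2,3) _ \<alpha>\<gamma> \<gamma>\<alpha> summand] \<gamma>_def by blast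
qed

section \<open>From conditions on split morphisms back to SSP\<close>

text \<open>The hypothesis is applied to \<gamma> restricted to \<open>A\<close>. It is injective
  there because \<alpha> is a left inverse, and its image is the whole graph.\<close>

lemma ssp_if_split_mono:
  assumes "\<And>A f. direct_summand R M A \<Longrightarrow> split_mono R (M\<lparr>carrier := A\<rparr>) M f \<Longrightarrow>
    direct_summand R M (A <+>\<^bsub>M\<^esub> f ` A)"
  shows "ssp R M"
  unfolding ssp_def
proof (intro allI impI, elim conjE)
  fix A B assume A: "direct_summand R M A" and B: "direct_summand R M B"
  have sub: "A \<subseteq> carrier M" using A submoduleD(1) unfolding direct_summand_def by blast
  show "direct_summand R M (A <+>\<^bsub>M\<^esub> B)"
  proof (rule graph_endomorphism[OF A B])
    fix \<alpha> \<beta> \<gamma>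
    assume hom: "\<alpha> \<in> module_homs R M M" "\<beta> \<in> module_homs R M M" "\<gamma> \<in> module_homs R M M" and
      \<alpha>: "\<And>x. x \<in> carrier M \<Longrightarrow> \<alpha> x \<in> A" "\<And>x. x \<in> A \<Longrightarrow> \<alpha> x = x" and
      \<gamma>: "\<And>x. x \<in> carrier M \<Longrightarrow> \<gamma> x = \<alpha> x \<oplus>\<^bsub>M\<^esub> (\<beta> (\<alpha> x) \<ominus>\<^bsub>M\<^esub> \<alpha> (\<beta> (\<alpha> x)))" and
      comp: "\<And>x. x \<in> carrier M \<Longrightarrow> \<alpha> (\<gamma> x) = \<alpha> x" "\<And>x. x \<in> carrier M \<Longrightarrow> \<gamma> (\<alpha> x) = \<gamma> x" and
      sm: "direct_summand R M (\<gamma> ` carrier M)" and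
      reduce: "direct_summand R M (A <+>\<^bsub>M\<^esub> \<gamma> ` carrier M) \<Longrightarrow> direct_summand R M (A <+>\<^bsub>M\<^esub> B)"
    \<comment> \<open>As \<gamma> x = \<gamma> (\<alpha> x), restricting to \<open>A\<close> does
      not shrink the image.\<close>
    have "\<gamma> x \<in> \<gamma> ` A" if "x \<in> carrier M" for x
      using comp(2)[OF that] \<alpha>(1)[OF that] by (metis imageI)
    then have im: "\<gamma> ` A = \<gamma> ` carrier M" using sub by blast
    have "\<gamma> \<in> module_homs R (M\<lparr>carrier := A\<rparr>) M"
      using hom(3) sub by (auto simp: module_homs_def subset_iff)
    moreover have "inj_on \<gamma> A"
      by (rule inj_on_inverseI[of _ \<alpha>]) (use comp(1) \<alpha>(2) sub in auto)
    ultimately have "split_mono R (M\<lparr>carrier := A\<rparr>) M \<gamma>"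
      using sm im by (simp add: split_mono_def)
    from assms[OF A this] show "direct_summand R M (A <+>\<^bsub>M\<^esub> B)" using reduce im by simp
  qed
qed

text \<open>The hypothesis is applied to the class of x - \<beta> (\<alpha> x) modulo
  \<open>A\<close>. This map is onto because it is the quotient map on the kernel of \<alpha>, which
  meets every coset of \<open>A\<close>; its kernel is the graph.\<close>

lemma ssp_if_split_epi:
  assumes "\<And>A f. direct_summand R M A \<Longrightarrow> split_epi R M (quotient_module M A) f \<Longrightarrow>
    direct_summand R M (A <+>\<^bsub>M\<^esub> a_kernel M (quotient_module M A) f)"
  shows "ssp R M"
  unfolding ssp_def
proof (intro allI impI, elim conjE)
  fix A B assume A: "direct_summand R M A" and B: "direct_summand R M B"
  have subm: "submodule A R M" using A unfolding direct_summand_def by blast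
  note A' = submoduleD[OF subm]
  interpret A: submodule A R M by fact
  interpret AA: abelian_subgroup A M
    by (intro abelian_subgroupI3 additive_subgroup.intro A.subgroup_axioms M.abelian_group_axioms)
  show "direct_summand R M (A <+>\<^bsub>M\<^esub> B)"
  proof (rule graph_endomorphism[OF A B])
    fix \<alpha> \<beta> \<gamma>
    assume hom: "\<alpha> \<in> module_homs R M M" "\<beta> \<in> module_homs R M M" "\<gamma> \<in> module_homs R M M" and
      \<alpha>: "\<And>x. x \<in> carrier M \<Longrightarrow> \<alpha> x \<in> A" "\<And>x. x \<in> A \<Longrightarrow> \<alpha> x = x" and
      \<gamma>: "\<And>x. x \<in> carrier M \<Longrightarrow> \<gamma> x = \<alpha> x \<oplus>\<^bsub>M\<^esub> (\<beta> (\<alpha> x) \<ominus>\<^bsub>M\<^esub> \<alpha> (\<beta> (\<alpha> x)))" and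
      comp: "\<And>x. x \<in> carrier M \<Longrightarrow> \<alpha> (\<gamma> x) = \<alpha> x" "\<And>x. x \<in> carrier M \<Longrightarrow> \<gamma> (\<alpha> x) = \<gamma> x" and
      sm: "direct_summand R M (\<gamma> ` carrier M)" and
      reduce: "direct_summand R M (A <+>\<^bsub>M\<^esub> \<gamma> ` carrier M) \<Longrightarrow> direct_summand R M (A <+>\<^bsub>M\<^esub> B)"
    note \<alpha>' = endoD[OF hom(1)] and \<beta>' = endoD[OF hom(2)] and \<gamma>' = endoD[OF hom(3)]
    let ?Q = "quotient_module M A"
    define u where "u x = x \<ominus>\<^bsub>M\<^esub> \<beta> (\<alpha> x)" for x
    have u: "u \<in> module_homs R M M"
      unfolding u_def by (intro endo_diff endo_ident endo_compose[OF hom(2,1)])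
    note u' = endoD[OF u]
    define \<phi> where "\<phi> x = A +>\<^bsub>M\<^esub> u x" for x
    have carrier_Q: "carrier ?Q = (\<lambda>x. A +>\<^bsub>M\<^esub> x) ` carrier M"
      by (auto simp: quotient_module_def A_RCOSETS_def')
    have "\<phi> \<in> module_homs R M ?Q"
      unfolding module_homs_def \<phi>_def
      using u'(1-3) carrier_Q AA.a_rcos_sum quotient_smult[OF subm]
      \<comment> \<open>Only the addition of the quotient is unfolded; its action stays folded so
        that \<open>quotient_smult\<close> can rewrite it.\<close>
      by (simp add: quotient_module_def[THEN arg_cong[where f = add]])
    moreover have "\<phi> ` carrier M = carrier ?Q"
    proof
      show "\<phi> ` carrier M \<subseteq> carrier ?Q" using u'(1) by (auto simp: carrier_Q \<phi>_def)
      have "A +>\<^bsub>M\<^esub> y \<in> \<phi> ` carrier M" if y: "y \<in> carrier M" for y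
      proof -
        \<comment> \<open>A representative of the coset of \<open>y\<close> that is killed by
          \<alpha>, hence fixed by \<open>u\<close>.\<close>
        let ?x = "y \<ominus>\<^bsub>M\<^esub> \<alpha> y"
        have x: "?x \<in> carrier M" using y \<alpha>'(1) by simp
        have "\<alpha> ?x = \<zero>\<^bsub>M\<^esub>"
          using y \<alpha> \<alpha>'(1) by (simp add: \<alpha>'(6)) (simp add: a_minus_def M.r_neg)
        then have "u ?x = ?x"
          using x by (simp add: u_def \<beta>'(4)) (simp add: a_minus_def)
        moreover have "?x \<in> A +>\<^bsub>M\<^esub> y"
        proof -
          have "?x = \<ominus>\<^bsub>M\<^esub> \<alpha> y \<oplus>\<^bsub>M\<^esub> y" using y \<alpha>'(1) by (simp add: a_minus_def M.a_comm)
          then show ?thesis using \<alpha>(1)[OF y] A'(4) by (auto simp: a_r_coset_def')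
        qed
        ultimately have "\<phi> ?x = A +>\<^bsub>M\<^esub> y"
          using AA.a_repr_independence' y by (simp add: \<phi>_def)
        then show ?thesis using x by (metis imageI)
      qed
      then show "carrier ?Q \<subseteq> \<phi> ` carrier M" by (auto simp: carrier_Q)
    qed
    moreover have ker: "a_kernel M ?Q \<phi> = \<gamma> ` carrier M"
    proof -
      \<comment> \<open>The zero of the quotient is the coset \<open>A\<close> itself, so the kernel
        consists of the \<open>x\<close> with \<open>u x\<close> in \<open>A\<close>.\<close>
      have "A +>\<^bsub>M\<^esub> y = A \<longleftrightarrow> y \<in> A" if "y \<in> carrier M" for y
        using that A'(3) AA.a_rcos_self AA.a_rcos_const by metis
      then have "a_kernel M ?Q \<phi> = {x \<in> carrier M. u x \<in> A}"
        using u'(1) by (auto simp: a_kernel_def' \<phi>_def quotient_module_def)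
      also have "\<dots> = \<gamma> ` carrier M"
      proof (intro equalityI subsetI)
        fix x assume "x \<in> {x \<in> carrier M. u x \<in> A}"
        then have x: "x \<in> carrier M" and "u x \<in> A" by auto
        \<comment> \<open>An element of \<open>A\<close> is fixed by \<alpha>, so \<open>u x\<close>
          equals \<alpha> (u x). Adding \<beta> (\<alpha> x) to both sides turns this into x =
          \<gamma> x.\<close>
        then have "u x = \<alpha> x \<ominus>\<^bsub>M\<^esub> \<alpha> (\<beta> (\<alpha> x))"
          using \<alpha>(2)[of "u x"] \<alpha>'(1) \<beta>'(1) by (simp add: u_def \<alpha>'(6))
        moreover have "x = u x \<oplus>\<^bsub>M\<^esub> \<beta> (\<alpha> x)"
          using x \<alpha>'(1) \<beta>'(1) by (simp add: u_def a_minus_def M.a_assoc M.l_neg)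
        ultimately have "x = \<gamma> x"
          using x \<alpha>'(1) \<beta>'(1) by (simp add: \<gamma> a_minus_def M.a_ac)
        then show "x \<in> \<gamma> ` carrier M" using x by blast
      next
        fix x assume "x \<in> \<gamma> ` carrier M"
        then obtain y where y: "y \<in> carrier M" "x = \<gamma> y" by blast
        \<comment> \<open>Because \<alpha> (\<gamma> y) = \<alpha> y, subtracting \<beta> (\<alpha>
          y) from \<gamma> y leaves only terms in the image of \<alpha>.\<close>
        then have "u x = \<alpha> y \<ominus>\<^bsub>M\<^esub> \<alpha> (\<beta> (\<alpha> y))"
          using \<alpha>'(1) \<beta>'(1) by (simp add: u_def comp(1))
            (simp add: \<gamma> a_minus_def M.a_ac M.r_neg M.r_neg1 M.r_neg2)
        moreover have "\<dots> \<in> A" using y \<alpha>(1) \<alpha>'(1) \<beta>'(1) A'(6) by blast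
        ultimately show "x \<in> {x \<in> carrier M. u x \<in> A}" using y \<gamma>'(1) by simp
      qed
      finally show ?thesis .
    qed
    ultimately have "split_epi R M ?Q \<phi>" using sm by (simp add: split_epi_def)
    from assms[OF A this] show "direct_summand R M (A <+>\<^bsub>M\<^esub> B)" using reduce ker by simp
  qed
qed

end

theorem proposition2p2:
  fixes R :: "('r, 's) ring_scheme" and M :: "('r, 'm, 't) module_scheme"
  assumes "right_module R M"
  shows "(ssp R M \<longleftrightarrow>
           (\<forall>A f. direct_summand R M A \<and> split_mono R (M\<lparr>carrier := A\<rparr>) M f \<longrightarrow>
              direct_summand R M (A <+>\<^bsub>M\<^esub> f ` A)))
       \<and> (ssp R M \<longleftrightarrow>
           (\<forall>A f. direct_summand R M A \<and> split_epi R M (quotient_module M A) f \<longrightarrow>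
              direct_summand R M (A <+>\<^bsub>M\<^esub> a_kernel M (quotient_module M A) f)))"
proof -
  interpret right_module R M by fact
  \<comment> \<open>Both forward implications are immediate, since a split monomorphism has a
    summand as image and a split epimorphism has one as kernel by definition.\<close>
  have "ssp R M \<Longrightarrow> direct_summand R M (A <+>\<^bsub>M\<^esub> f ` A)"
    if "direct_summand R M A" "split_mono R (M\<lparr>carrier := A\<rparr>) M f" for A and f :: "'m \<Rightarrow> 'm"
    using that by (simp add: ssp_def split_mono_def)
  moreover have "ssp R M \<Longrightarrow> direct_summand R M (A <+>\<^bsub>M\<^esub> a_kernel M (quotient_module M A) f)"
    if "direct_summand R M A" "split_epi R M (quotient_module M A) f" for A and f :: "'m \<Rightarrow> 'm set"
    using that by (simp add: ssp_def split_epi_def)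
  ultimately show ?thesis
    using ssp_if_split_mono ssp_if_split_epi by blast
qed

end
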